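(* Let $\mathcal{H}$ be a complex separable Hilbert space, $W$ a bounded positive semi-definite operator on $\mathcal{H}$ and $\mathcal{S}$ a (not necessarily closed) subspace of $\mathcal{H}$. If $W$ is $\mathcal{S}$-complementable, then $$\mathcal{S}^\perp(W)=W(I-P_{W,\mathcal{S}}),$$ where $\mathcal{S}^\perp(W)$ is the Schur complement of $W$ to $\mathcal{S}^\perp$.
   Context: A linear relation in $\mathcal{H}$ is a linear subspace $T$ of $\mathcal{H}\times\mathcal{H}$; operators are identified with their graphs. $RT=\{(x,y): (x,z)\in T,\ (z,y)\in R\text{ for some }z\}$ and $I-T=\{(x,x-y):(x,y)\in T\}$. $P_{W,\mathcal{S}}:=\{(s+n,s):s\in\mathcal{S},\ n\in(W\mathcal{S})^\perp\}$, where $(W\mathcal{S})^\perp=\{x:\langle Wx,s\rangle=0\ \forall s\in\mathcal{S}\}$. $W$ is $\mathcal{S}$-complementable if $\operatorname{dom}P_{W,\mathcal{S}}=\mathcal{H}$, i.e. $\mathcal{S}+(W\mathcal{S})^\perp=\mathcal{H}$. For a closed subspace $\mathcal{T}$ of $\mathcal{H}$, the Schur complement $\mathcal{T}(W)$ of $W$ to $\mathcal{T}$ is the maximum element (which exists) of $\{X\in L(\mathcal{H}):0\le X\le W,\ \operatorname{ran}X\subseteq\mathcal{T}\}$, where $L(\mathcal{H})$ denotes the bounded operators on $\mathcal{H}$ and $\le$ is the usual order on bounded selfadjoint operators. *)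

theory Defs
  imports "HOL-Analysis.Analysis"
begin

text \<open>
  The inner product is linear in the first and conjugate linear in the second argument.
  Real scalar multiplication, norm and topology are those of the library classes; the axioms tie
  them to the complex structure, so the class is precisely that of complex inner product spaces
  with the norm topology.
\<close>

class complex_inner = real_normed_vector +
  fixes scaleC :: "complex \<Rightarrow> 'a \<Rightarrow> 'a" (infixr \<open>*\<^sub>C\<close> 75)
    and cinner :: "'a \<Rightarrow> 'a \<Rightarrow> complex"
  assumes scaleC_add_right: "a *\<^sub>C (x + y) = a *\<^sub>C x + a *\<^sub>C y"
    and scaleC_add_left: "(a + b) *\<^sub>C x = a *\<^sub>C x + b *\<^sub>C x"
    and scaleC_scaleC: "a *\<^sub>C b *\<^sub>C x = (a * b) *\<^sub>C x"
    and scaleC_one: "1 *\<^sub>C x = x"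
    and scaleR_scaleC: "scaleR r x = complex_of_real r *\<^sub>C x"
    and cinner_commute: "cinner x y = cnj (cinner y x)"
    and cinner_add_left: "cinner (x + y) z = cinner x z + cinner y z"
    and cinner_scaleC_left: "cinner (a *\<^sub>C x) y = a * cinner x y"
    and cinner_self_ge_zero: "0 \<le> Re (cinner x x)"
    and cinner_eq_zero: "cinner x x = 0 \<longleftrightarrow> x = 0"
    and norm_eq_sqrt_cinner: "norm x = sqrt (Re (cinner x x))"

class chilbert_space = complex_inner + complete_space

global_interpretation complex_vector:
  vector_space "scaleC :: complex \<Rightarrow> 'a \<Rightarrow> 'a::complex_inner"
  by standard (simp_all add: scaleC_add_right scaleC_add_left scaleC_scaleC scaleC_one)

instantiation complex :: chilbert_space
begin

definition scaleC_complex :: "complex \<Rightarrow> complex \<Rightarrow> complex"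
  where "scaleC_complex a x = a * x"

definition cinner_complex :: "complex \<Rightarrow> complex \<Rightarrow> complex"
  where "cinner_complex x y = x * cnj y"

instance
  by standard
    (auto simp: scaleC_complex_def cinner_complex_def algebra_simps scaleR_conv_of_real
      complex_norm cmod_def power2_eq_square)

end

definition csubspace :: "'a::complex_inner set \<Rightarrow> bool"
  where "csubspace S \<longleftrightarrow> module.subspace scaleC S"

definition bounded_clinear :: "('a::complex_inner \<Rightarrow> 'b::complex_inner) \<Rightarrow> bool"
  where "bounded_clinear A \<longleftrightarrow>
    Vector_Spaces.linear scaleC scaleC A \<and> (\<exists>K. \<forall>x. norm (A x) \<le> norm x * K)"

definition selfadjoint :: "('a::complex_inner \<Rightarrow> 'a) \<Rightarrow> bool"
  where "selfadjoint A \<longleftrightarrow> bounded_clinear A \<and> (\<forall>x y. cinner (A x) y = cinner x (A y))"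

text \<open>The quadratic forms below are real valued, since both operators are selfadjoint.\<close>

definition op_le :: "('a::complex_inner \<Rightarrow> 'a) \<Rightarrow> ('a \<Rightarrow> 'a) \<Rightarrow> bool"
  where "op_le A B \<longleftrightarrow> selfadjoint A \<and> selfadjoint B \<and>
    (\<forall>x. Re (cinner (A x) x) \<le> Re (cinner (B x) x))"

abbreviation positive_op :: "('a::complex_inner \<Rightarrow> 'a) \<Rightarrow> bool"
  where "positive_op A \<equiv> op_le (\<lambda>_. 0) A"

definition orth :: "'a::complex_inner set \<Rightarrow> 'a set"
  where "orth S = {x. \<forall>s\<in>S. cinner x s = 0}"

text \<open>
  The product of relations written \<open>R T\<close> (first \<open>T\<close>, then \<open>R\<close>) is \<open>T O R\<close> in the library's
  notation, and the domain of a relation is \<^const>\<open>Domain\<close>.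
\<close>

definition op_graph :: "('a \<Rightarrow> 'b) \<Rightarrow> ('a \<times> 'b) set"
  where "op_graph A = {(x, A x) | x. True}"

definition lrel_comp :: "('b \<times> 'c) set \<Rightarrow> ('a \<times> 'b) set \<Rightarrow> ('a \<times> 'c) set"
  where "lrel_comp R T = T O R"

definition id_minus :: "('a::complex_inner \<times> 'a) set \<Rightarrow> ('a \<times> 'a) set"
  where "id_minus T = {(x, x - y) | x y. (x, y) \<in> T}"

text \<open>The set \<open>(W S)\<^sup>\<bottom>\<close>; see \<open>W_orth_eq_orth_image\<close> for selfadjoint \<open>W\<close>.\<close>

definition W_orth :: "('a::complex_inner \<Rightarrow> 'a) \<Rightarrow> 'a set \<Rightarrow> 'a set"
  where "W_orth W S = {x. \<forall>s\<in>S. cinner (W x) s = 0}"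

lemma W_orth_eq_orth_image: "selfadjoint W \<Longrightarrow> W_orth W S = orth (W ` S)"
  by (simp add: W_orth_def orth_def selfadjoint_def)

definition W_proj :: "('a::complex_inner \<Rightarrow> 'a) \<Rightarrow> 'a set \<Rightarrow> ('a \<times> 'a) set"
  where "W_proj W S = {(s + n, s) | s n. s \<in> S \<and> n \<in> W_orth W S}"

definition complementable :: "('a::complex_inner \<Rightarrow> 'a) \<Rightarrow> 'a set \<Rightarrow> bool"
  where "complementable W S \<longleftrightarrow> Domain (W_proj W S) = UNIV"

text \<open>The description operator is meaningful for positive \<open>W\<close> and closed \<open>T\<close>; antisymmetry of the
  operator order makes the maximum unique.\<close>

definition schur_set :: "('a::complex_inner \<Rightarrow> 'a) \<Rightarrow> 'a set \<Rightarrow> ('a \<Rightarrow> 'a) set"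
  where "schur_set W T = {X. bounded_clinear X \<and> positive_op X \<and> op_le X W \<and> range X \<subseteq> T}"

definition schur_complement :: "('a::complex_inner \<Rightarrow> 'a) \<Rightarrow> 'a set \<Rightarrow> 'a \<Rightarrow> 'a"
  where "schur_complement W T = (THE X. X \<in> schur_set W T \<and> (\<forall>Y\<in>schur_set W T. op_le Y X))"

end

theory Submission
  imports Defs
begin

text \<open>
  Complementability lets one write every \<open>x\<close> as \<open>s + n\<close> with \<open>s \<in> S\<close> and \<open>n \<in> (W S)\<^sup>\<bottom>\<close>, and
  \<open>W (I - P)\<close> relates \<open>x\<close> to \<open>W n\<close>. The value \<open>W n\<close> does not depend on the decomposition, because
  \<open>W\<close> vanishes on \<open>S \<inter> (W S)\<^sup>\<bottom>\<close>. The resulting map \<open>X\<close> satisfies \<open>\<langle>X x, x\<rangle> = \<langle>W n, n\<rangle>\<close> and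
  \<open>\<langle>W x, x\<rangle> = \<langle>W s, s\<rangle> + \<langle>W n, n\<rangle>\<close>, so \<open>0 \<le> X \<le> W\<close>, and the Cauchy--Schwarz estimate
  \<open>\<parallel>W n\<parallel>\<^sup>2 \<le> K \<langle>W n, n\<rangle>\<close> makes it bounded. A competitor \<open>Y \<le> W\<close> with range in \<open>S\<^sup>\<bottom>\<close> kills \<open>S\<close>, so
  \<open>\<langle>Y x, x\<rangle> = \<langle>Y n, n\<rangle> \<le> \<langle>W n, n\<rangle> = \<langle>X x, x\<rangle>\<close>.
\<close>

lemma cinner_add_right: "cinner x (y + z) = cinner x y + cinner (x::'a::complex_inner) z"
  by (metis cinner_add_left cinner_commute complex_cnj_add)

lemma cinner_scaleR_left: "cinner (r *\<^sub>R x) y = of_real r * cinner (x::'a::complex_inner) y"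
  by (simp add: scaleR_scaleC cinner_scaleC_left)

lemma cinner_zero_left [simp]: "cinner 0 (x::'a::complex_inner) = 0"
  using cinner_add_left[of 0 0 x] by simp

lemma cinner_zero_right [simp]: "cinner (x::'a::complex_inner) 0 = 0"
  using cinner_add_right[of x 0 0] by simp

lemma cinner_diff_left: "cinner (x - y) z = cinner x z - cinner (y::'a::complex_inner) z"
  using cinner_add_left[of "x - y" y z] by simp

lemma cinner_self_eq_norm_square: "Re (cinner x x) = (norm (x::'a::complex_inner))\<^sup>2"
  by (simp add: norm_eq_sqrt_cinner cinner_self_ge_zero)

lemma bounded_clinear_iff:
  "bounded_clinear A \<longleftrightarrow> (\<forall>x y. A (x + y) = A x + A y) \<and> (\<forall>c x. A (c *\<^sub>C x) = c *\<^sub>C A x)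
    \<and> (\<exists>K. \<forall>x. norm (A x) \<le> norm x * K)"
  unfolding bounded_clinear_def Vector_Spaces.linear_def module_hom_def module_hom_axioms_def
  by (simp add: complex_vector.module_axioms complex_vector.vector_space_axioms)

lemma bounded_clinear_add: "bounded_clinear A \<Longrightarrow> A (x + y) = A x + A y"
  and bounded_clinear_scaleC: "bounded_clinear A \<Longrightarrow> A (c *\<^sub>C x) = c *\<^sub>C A x"
  by (simp_all add: bounded_clinear_iff)

lemma bounded_clinear_scaleR: "bounded_clinear A \<Longrightarrow> A (r *\<^sub>R x) = r *\<^sub>R A x"
  by (simp add: scaleR_scaleC bounded_clinear_scaleC)

lemma bounded_clinear_diff: "bounded_clinear A \<Longrightarrow> A (x - y) = A x - A y"
  using bounded_clinear_add[of A "x - y" y] by simp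

text \<open>The form may be degenerate, so the same result serves the real part of the inner product
  and that of \<open>\<langle>W x, y\<rangle>\<close>. It follows from positivity of
  \<open>B\<close> on real combinations of \<open>x\<close> and \<open>y\<close>.\<close>

lemma Cauchy_Schwarz_form:
  fixes B :: "'a::real_vector \<Rightarrow> 'a \<Rightarrow> real"
  assumes add: "\<And>x y z. B (x + y) z = B x z + B y z"
    and scale: "\<And>r x y. B (r *\<^sub>R x) y = r * B x y"
    and sym: "\<And>x y. B x y = B y x"
    and pos: "\<And>x. 0 \<le> B x x"
  shows "(B x y)\<^sup>2 \<le> B x x * B y y"
proof -
  have add_right: "B x (y + z) = B x y + B x z" and scale_right: "B x (r *\<^sub>R y) = r * B x y"
    for r x y z
    by (metis add sym) (metis scale sym)
  have expand: "B (a *\<^sub>R x + b *\<^sub>R y) (a *\<^sub>R x + b *\<^sub>R y)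
      = a\<^sup>2 * B x x + 2 * a * b * B x y + b\<^sup>2 * B y y" for a b
    using sym[of y x]
    by (simp add: add scale add_right scale_right power2_eq_square algebra_simps)
  show ?thesis
  proof (cases "B y y = 0")
    case True
    have "0 \<le> 2 * a * B x y + B x x" for a
      using pos[of "1 *\<^sub>R x + a *\<^sub>R y"] unfolding expand True by simp
    \<comment> \<open>The bound is affine in \<open>a\<close>; if \<open>B x y\<close> were nonzero,
      this \<open>a\<close> would give it the value -1.\<close>
    from this[of "- (B x x + 1) / (2 * B x y)"] have "B x y = 0"
      by (cases "B x y = 0") (simp_all add: field_simps)
    then show ?thesis using True by simp
  next
    case False
    then have "0 < B y y" using pos[of y] by simp
    \<comment> \<open>Up to the factor \<open>B y y\<close>, the test vector is the component of
      \<open>x\<close> that is \<open>B\<close>-orthogonal to \<open>y\<close>.\<close>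
    have "0 \<le> B y y * (B x x * B y y - (B x y)\<^sup>2)"
      using pos[of "B y y *\<^sub>R x + (- B x y) *\<^sub>R y"] unfolding expand
      by (simp add: power2_eq_square algebra_simps)
    then show ?thesis using \<open>0 < B y y\<close> by (simp add: zero_le_mult_iff)
  qed
qed

lemma Re_cinner_le_norm_mult: "Re (cinner x y) \<le> norm x * norm (y::'a::complex_inner)"
proof -
  have "(Re (cinner x y))\<^sup>2 \<le> Re (cinner x x) * Re (cinner y y)"
    by (rule Cauchy_Schwarz_form)
      (simp_all add: cinner_add_left cinner_scaleR_left cinner_self_ge_zero,
        metis cinner_commute cnj.sel(1))
  then have "(Re (cinner x y))\<^sup>2 \<le> (norm x * norm y)\<^sup>2"
    by (simp add: cinner_self_eq_norm_square power_mult_distrib)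
  then show ?thesis by (rule power2_le_imp_le) simp
qed

lemma selfadjoint_Re_cinner_commute:
  "selfadjoint A \<Longrightarrow> Re (cinner (A x) y) = Re (cinner (A y) x)"
  by (metis cinner_commute cnj.sel(1) selfadjoint_def)

text \<open>Cauchy--Schwarz for the form of \<open>W\<close> at the pair \<open>x\<close>,
  \<open>W x\<close> replaces an argument with the square root of \<open>W\<close>.\<close>

lemma positive_op_norm_square_bound:
  assumes "positive_op W"
  obtains K where "K > 0" "\<And>x. (norm (W x))\<^sup>2 \<le> K * Re (cinner (W x) x)"
    "\<And>x. norm (W x) \<le> K * norm x"
proof -
  have sa: "selfadjoint W" and pos: "\<And>x. 0 \<le> Re (cinner (W x) x)"
    using assms by (simp_all add: op_le_def)
  have lin: "bounded_clinear W" using sa by (simp add: selfadjoint_def)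
  then obtain K0 where K0: "\<And>x. norm (W x) \<le> norm x * K0" by (auto simp: bounded_clinear_iff)
  \<comment> \<open>The maximum with 1 makes the constant strictly positive.\<close>
  define K where "K = max K0 1"
  have K: "norm (W x) \<le> K * norm x" for x
    using K0[of x] mult_left_mono[of K0 K "norm x"] by (simp add: K_def mult.commute)
  have "K > 0" by (simp add: K_def)
  have bound: "(norm (W x))\<^sup>2 \<le> K * Re (cinner (W x) x)" for x
  proof (cases "W x = 0")
    case False
    have "(Re (cinner (W x) (W x)))\<^sup>2
        \<le> Re (cinner (W x) x) * Re (cinner (W (W x)) (W x))"
      by (rule Cauchy_Schwarz_form)
        (simp_all add: bounded_clinear_add[OF lin] bounded_clinear_scaleR[OF lin] cinner_add_left
          cinner_scaleR_left pos selfadjoint_Re_cinner_commute[OF sa])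
    also have "\<dots> \<le> Re (cinner (W x) x) * (K * (norm (W x))\<^sup>2)"
      using Re_cinner_le_norm_mult[of "W (W x)" "W x"] K[of "W x"]
      by (intro mult_left_mono pos)
        (smt (verit) mult_right_mono norm_ge_zero power2_eq_square mult.assoc)
    finally have "(norm (W x))\<^sup>2 * (norm (W x))\<^sup>2
        \<le> (K * Re (cinner (W x) x)) * (norm (W x))\<^sup>2"
      by (simp add: cinner_self_eq_norm_square power2_eq_square mult_ac)
    then show ?thesis by (rule mult_right_le_imp_le) (simp add: False)
  qed (use \<open>K > 0\<close> pos in simp)
  from that[OF \<open>K > 0\<close> bound K] show thesis .
qed

text \<open>Polarization: the quadratic forms agree, hence so do the real parts of the sesquilinear
  forms, which are then tested on \<open>A x - B x\<close>.\<close>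

lemma op_le_antisym:
  assumes "op_le A B" "op_le B A"
  shows "A = B"
proof
  fix x
  have A: "selfadjoint A" "bounded_clinear A" and B: "selfadjoint B" "bounded_clinear B"
    and eq: "\<And>x. Re (cinner (A x) x) = Re (cinner (B x) x)"
    using assms by (auto simp: op_le_def selfadjoint_def intro: antisym)
  have "Re (cinner (A x) y) = Re (cinner (B x) y)" for y
    using eq[of "x + y"] eq[of x] eq[of y]
      selfadjoint_Re_cinner_commute[OF A(1), of x y] selfadjoint_Re_cinner_commute[OF B(1), of x y]
    by (simp add: bounded_clinear_add A B cinner_add_left cinner_add_right)
  from this[of "A x - B x"] have "Re (cinner (A x - B x) (A x - B x)) = 0"
    by (simp add: cinner_diff_left)
  then show "A x = B x" by (simp add: cinner_self_eq_norm_square)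
qed

lemma schur_complement_eqI:
  assumes "X \<in> schur_set W T" "\<And>Y. Y \<in> schur_set W T \<Longrightarrow> op_le Y X"
  shows "schur_complement W T = X"
  unfolding schur_complement_def using assms by (intro the_equality) (auto intro: op_le_antisym)

lemma lrel_comp_W_proj:
  "lrel_comp (op_graph W) (id_minus (W_proj W S))
    = {(s + n, W n) | s n. s \<in> S \<and> n \<in> W_orth W S}"
proof -
  have "id_minus (W_proj W S) = {(s + n, n) | s n. s \<in> S \<and> n \<in> W_orth W S}"
    unfolding id_minus_def W_proj_def by force
  then show ?thesis by (auto simp: lrel_comp_def op_graph_def)
qed

text \<open>Allowing any decomposition \<open>s + n\<close> gives in one statement the value of the
  Schur complement and the single-valuedness of \<open>W (I - P)\<close>.\<close>

lemma schur_complement_decomposition: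
  fixes S :: "'a::complex_inner set"
  assumes W: "positive_op W" and S: "csubspace S" and compl: "complementable W S"
    and s: "s \<in> S" and n: "n \<in> W_orth W S"
  shows "schur_complement W (orth S) (s + n) = W n"
proof -
  have sa: "selfadjoint W" and pos: "\<And>x. 0 \<le> Re (cinner (W x) x)"
    using W by (simp_all add: op_le_def)
  have lin: "bounded_clinear W" using sa by (simp add: selfadjoint_def)
  have S': "complex_vector.subspace S" using S by (simp add: csubspace_def)
  obtain K where "K > 0" and K: "\<And>x. (norm (W x))\<^sup>2 \<le> K * Re (cinner (W x) x)"
    and KW: "\<And>x. norm (W x) \<le> K * norm x"
    using positive_op_norm_square_bound[OF W] by blast
  have orth0: "cinner (W n) s = 0" if "n \<in> W_orth W S" "s \<in> S" for n s
    using that by (simp add: W_orth_def)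
  have orth1: "cinner (W s) n = 0" if "n \<in> W_orth W S" "s \<in> S" for n s
    using orth0[OF that] sa by (metis cinner_commute complex_cnj_zero selfadjoint_def)
  \<comment> \<open>Here \<open>\<langle>W d, d\<rangle> = 0\<close>, and the norm of
    \<open>W d\<close> is controlled by this value.\<close>
  have W_kernel: "W d = 0" if "d \<in> S" "d \<in> W_orth W S" for d
    using K[of d] orth0[OF that(2,1)] by simp
  have "\<exists>n. n \<in> W_orth W S \<and> x - n \<in> S" for x
  proof -
    have "x \<in> Domain (W_proj W S)" using compl by (simp add: complementable_def)
    then show ?thesis by (auto simp: W_proj_def)
  qed
  \<comment> \<open>\<open>N\<close> is a mere choice function and need not be linear; linearity is
    shown only for its composite with \<open>W\<close>.\<close>
  then obtain N where N: "\<And>x. N x \<in> W_orth W S" and NS: "\<And>x. x - N x \<in> S" by metis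
  define X where "X x = W (N x)" for x
  have X_eq: "X (s + n) = W n" if "s \<in> S" "n \<in> W_orth W S" for s n
  proof -
    \<comment> \<open>Two decompositions of one vector differ by an element of
      \<open>S \<inter> W_orth W S\<close>, where \<open>W\<close> vanishes.\<close>
    have "N (s + n) - n = s - (s + n - N (s + n))" by simp
    then have "N (s + n) - n \<in> S"
      using complex_vector.subspace_diff[OF S' that(1) NS] by metis
    moreover have "N (s + n) - n \<in> W_orth W S"
      using that(2) N[of "s + n"] by (simp add: W_orth_def bounded_clinear_diff[OF lin] cinner_diff_left)
    ultimately show ?thesis using W_kernel bounded_clinear_diff[OF lin] unfolding X_def by fastforce
  qed
  have X_form: "cinner (X x) y = cinner (W (N x)) (N y)" for x y
    using cinner_add_right[of "W (N x)" "y - N y" "N y"] orth0[OF N NS] by (simp add: X_def)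
  have W_form: "Re (cinner (W x) x)
      = Re (cinner (W (x - N x)) (x - N x)) + Re (cinner (W (N x)) (N x))" for x
  proof -
    have "cinner (W (x - N x + N x)) (x - N x + N x)
        = cinner (W (x - N x)) (x - N x) + cinner (W (N x)) (N x)"
      unfolding bounded_clinear_add[OF lin, of "x - N x"] cinner_add_left cinner_add_right
        orth0[OF N NS] orth1[OF N NS] by simp
    then show ?thesis by simp
  qed
  have X_le: "Re (cinner (X x) x) \<le> Re (cinner (W x) x)" for x
    using W_form[of x] pos[of "x - N x"] by (simp add: X_form)
  have X_lin: "bounded_clinear X"
    unfolding bounded_clinear_iff
  proof (intro conjI allI exI)
    fix x y
    \<comment> \<open>The sum of the chosen decompositions decomposes \<open>x + y\<close>, so
      \<open>X_eq\<close> applies whatever \<open>N (x + y)\<close> is.\<close>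
    have "N x + N y \<in> W_orth W S"
      using N by (simp add: W_orth_def bounded_clinear_add[OF lin] cinner_add_left)
    from X_eq[OF complex_vector.subspace_add[OF S' NS[of x] NS[of y]] this]
    show "X (x + y) = X x + X y" by (simp add: X_def bounded_clinear_add[OF lin])
  next
    fix c x
    have "c *\<^sub>C N x \<in> W_orth W S"
      using N by (simp add: W_orth_def bounded_clinear_scaleC[OF lin] cinner_scaleC_left)
    from X_eq[OF complex_vector.subspace_scale[OF S' NS[of x]] this, of c]
    show "X (c *\<^sub>C x) = c *\<^sub>C X x"
      by (simp add: X_def bounded_clinear_scaleC[OF lin] flip: scaleC_add_right)
  next
    fix x
    \<comment> \<open>With no bound on \<open>N x\<close> at hand, the estimate passes through
      \<open>\<langle>W (N x), N x\<rangle> \<le> \<langle>W x, x\<rangle>\<close>.\<close>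
    have "(norm (X x))\<^sup>2 \<le> K * Re (cinner (W x) x)"
      using order_trans[OF K[of "N x"] mult_left_mono[OF X_le[of x, unfolded X_form]]] \<open>K > 0\<close>
      by (simp add: X_def)
    also have "\<dots> \<le> K * (K * norm x * norm x)"
      using Re_cinner_le_norm_mult[of "W x" x] mult_right_mono[OF KW[of x], of "norm x"] \<open>K > 0\<close>
      by (intro mult_left_mono) auto
    finally have "(norm (X x))\<^sup>2 \<le> (norm x * K)\<^sup>2" by (simp add: power2_eq_square mult_ac)
    then show "norm (X x) \<le> norm x * K"
      by (rule power2_le_imp_le) (use \<open>K > 0\<close> in simp)
  qed
  have X_sa: "selfadjoint X"
    unfolding selfadjoint_def
  proof (intro conjI allI X_lin)
    fix x y
    show "cinner (X x) y = cinner x (X y)"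
      using sa X_form[of x y] X_form[of y x] by (metis cinner_commute selfadjoint_def)
  qed
  have "range X \<subseteq> orth S" using orth0[OF N] by (auto simp: orth_def X_def)
  then have "X \<in> schur_set W (orth S)"
    using W sa X_lin X_sa X_le pos by (simp add: schur_set_def op_le_def X_form)
  moreover have "op_le Y X" if "Y \<in> schur_set W (orth S)" for Y
  proof -
    have Y: "bounded_clinear Y" "selfadjoint Y"
      and YS: "\<And>x s. s \<in> S \<Longrightarrow> cinner (Y x) s = 0"
      and Y_le: "\<And>x. Re (cinner (Y x) x) \<le> Re (cinner (W x) x)"
      using that by (auto simp: schur_set_def op_le_def orth_def image_subset_iff)
    \<comment> \<open>By selfadjointness, \<open>\<langle>Y s, Y s\<rangle> = \<langle>Y (Y s),
      s\<rangle> = 0\<close>.\<close>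
    have "Y s = 0" if "s \<in> S" for s
      using YS[OF that, of "Y s"] Y(2)
      by (metis cinner_commute cinner_eq_zero complex_cnj_zero selfadjoint_def)
    then have "Y x = Y (N x)" for x
      using bounded_clinear_diff[OF Y(1), of x "N x"] NS[of x] by simp
    then have "cinner (Y x) x = cinner (Y (N x)) (N x)" for x
      using cinner_add_right[of "Y x" "x - N x" "N x"] YS[OF NS[of x], of x] by simp
    then have "Re (cinner (Y x) x) \<le> Re (cinner (X x) x)" for x
      using Y_le[of "N x"] by (simp add: X_form)
    then show ?thesis using X_sa Y by (simp add: op_le_def)
  qed
  ultimately have "schur_complement W (orth S) = X" by (rule schur_complement_eqI)
  then show ?thesis using X_eq[OF s n] by simp
qed

theorem corollary4p8:
  fixes W :: "'a::chilbert_space \<Rightarrow> 'a" and S :: "'a set"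
  assumes "separable_space (euclidean :: 'a topology)"
    and "bounded_clinear W" and "positive_op W"
    and "csubspace S"
    and "complementable W S"
  shows "op_graph (schur_complement W (orth S)) = lrel_comp (op_graph W) (id_minus (W_proj W S))"
proof -
  note decomp = schur_complement_decomposition[OF assms(3-5)]
  \<comment> \<open>This puts the graph inside the product relation, given \<open>decomp\<close>;
    the reverse inclusion is \<open>decomp\<close> alone.\<close>
  have "\<exists>s n. x = s + n \<and> s \<in> S \<and> n \<in> W_orth W S" for x
  proof -
    have "x \<in> Domain (W_proj W S)" using assms(5) by (simp add: complementable_def)
    then show ?thesis by (auto simp: W_proj_def)
  qed
  then show ?thesis
    unfolding lrel_comp_W_proj unfolding op_graph_def using decomp by fastforce
qed

end
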